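(* Let $I=[0,1]$ and let $\widetilde p$ be the exponent function on $I$ defined in the context. The space $C(I)$ of continuous functions on $I$ is a closed linear subspace of $L^{\widetilde p(\cdot)}(I)$.
   Context: Let $I=[0,1]$. For measurable $p:I\to[1,\infty)$ (finite values being required only almost everywhere), $L^{p(\cdot)}(I)$ is the space of measurable $f$ on $I$ with $\int_0^1(|f(x)|/\lambda)^{p(x)}dx<\infty$ for some $\lambda>0$, normed by $\|f\|_{p(\cdot)}=\inf\{\lambda>0:\int_0^1(|f(x)|/\lambda)^{p(x)}dx\le1\}$. "Closed" refers to this norm. The exponent $\widetilde p$: let $m(x)=\chi_{(0,1/200)}(x)\log(1/x)$ for $x\in(0,1]$; let $\{\delta_k\}_{k\ge1}$ be a sequence of positive numbers with $\lim_{k\to\infty}\delta_k=0$ and $\sum_{k=1}^\infty\int_0^{\delta_k}\log(1/x)\,dx<\infty$; let $\{r_k\}_{k\ge1}$ be an enumeration of the rationals in $I$ (or of some countable dense set in $I$). For $x\in I$ put $$\widetilde p(x)=2+\sum_{k=1}^\infty m(x-r_k)\,\chi_{(r_k,r_k+\delta_k)}(x),$$ where the $k$-th term is $0$ if $x\notin(r_k,r_k+\delta_k)$. The function $\widetilde p$ is finite a.e. on $I$. *)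

theory Defs
  imports "HOL-Analysis.Analysis"
begin

abbreviation I_measure :: "real measure"
  where "I_measure \<equiv> lebesgue_on {0..1}"

definition ae_equal :: "(real \<Rightarrow> real) \<Rightarrow> (real \<Rightarrow> real) \<Rightarrow> bool"
  where "ae_equal f g \<longleftrightarrow>
    f \<in> borel_measurable I_measure \<and> g \<in> borel_measurable I_measure \<and> (AE x in I_measure. f x = g x)"

text \<open>Real-valued measurable functions on \<open>[0,1]\<close> modulo equality almost everywhere. Functions are
  total, but only their values on \<open>[0,1]\<close> matter.\<close>

quotient_type L0 = "real \<Rightarrow> real" / partial: ae_equal
proof (rule part_equivpI)
  show "\<exists>f. ae_equal f f"
    by (rule exI[of _ "\<lambda>_. 0"]) (simp add: ae_equal_def)
  show "symp ae_equal"
    by (auto simp: symp_def ae_equal_def elim: eventually_mono)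
  show "transp ae_equal"
    by (auto simp: transp_def ae_equal_def elim: eventually_elim2)
qed

instantiation L0 :: real_vector
begin

lift_definition zero_L0 :: L0 is "\<lambda>_. 0"
  by (simp add: ae_equal_def)

lift_definition plus_L0 :: "L0 \<Rightarrow> L0 \<Rightarrow> L0" is "\<lambda>f g x. f x + g x"
  by (auto simp: ae_equal_def elim: eventually_elim2)

lift_definition minus_L0 :: "L0 \<Rightarrow> L0 \<Rightarrow> L0" is "\<lambda>f g x. f x - g x"
  by (auto simp: ae_equal_def elim: eventually_elim2)

lift_definition uminus_L0 :: "L0 \<Rightarrow> L0" is "\<lambda>f x. - f x"
  by (auto simp: ae_equal_def elim: eventually_mono)

lift_definition scaleR_L0 :: "real \<Rightarrow> L0 \<Rightarrow> L0" is "\<lambda>c f x. c * f x"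
  by (auto simp: ae_equal_def elim: eventually_mono)

instance
  by standard (transfer; auto simp: ae_equal_def algebra_simps)+

end

text \<open>The exponent is extended-valued because \<open>p_tilde\<close> below may be infinite on a null set;
  there \<^const>\<open>enn2real\<close> turns the value into \<open>0\<close>, which does not affect the integral.\<close>

lift_definition modular :: "(real \<Rightarrow> ennreal) \<Rightarrow> L0 \<Rightarrow> ennreal"
  is "\<lambda>p f. \<integral>\<^sup>+x. ennreal (\<bar>f x\<bar> powr enn2real (p x)) \<partial>I_measure"
  by (intro nn_integral_cong_AE) (auto simp: ae_equal_def elim: eventually_mono)

definition Lp_space :: "(real \<Rightarrow> ennreal) \<Rightarrow> L0 set"
  where "Lp_space p = {f. \<exists>l>0. modular p (f /\<^sub>R l) < \<infinity>}"

text \<open>The Luxemburg norm. As an infimum in \<^typ>\<open>ennreal\<close> it is \<open>\<infinity>\<close> outside \<open>Lp_space p\<close>, whereas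
  the infimum of an empty set of reals would be unspecified. That \<open>Lp_dist p\<close> is a metric on \<open>Lp_space p\<close>
  is \<open>exponent.Metric_space_Lp\<close>, for measurable \<open>p\<close> with \<open>1 \<le> p < \<infinity>\<close> almost everywhere.\<close>

definition Lp_norm :: "(real \<Rightarrow> ennreal) \<Rightarrow> L0 \<Rightarrow> ennreal"
  where "Lp_norm p f = (INF l \<in> {l. 0 < l \<and> modular p (f /\<^sub>R l) \<le> 1}. ennreal l)"

definition Lp_dist :: "(real \<Rightarrow> ennreal) \<Rightarrow> L0 \<Rightarrow> L0 \<Rightarrow> real"
  where "Lp_dist p f g = enn2real (Lp_norm p (f - g))"

lemma powr_convex_abs:
  fixes u v a b q :: real
  assumes "1 \<le> q" "0 \<le> a" "0 \<le> b" "a + b = 1"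
  shows "\<bar>a * u + b * v\<bar> powr q \<le> a * \<bar>u\<bar> powr q + b * \<bar>v\<bar> powr q"
proof -
  have small: "c powr q \<le> c" if "0 \<le> c" "c \<le> 1" for c :: real
    using powr_mono'[of 1 q c] that assms(1) by simp
  have pos: "(a * s + b * t) powr q \<le> a * s powr q + b * t powr q" if "0 \<le> s" "0 \<le> t" for s t
  proof -
    consider "s = 0" | "t = 0" | "0 < s \<and> 0 < t"
      using \<open>0 \<le> s\<close> \<open>0 \<le> t\<close> by fastforce
    then show ?thesis
    proof cases
      case 1
      then show ?thesis using small[of b] assms that by (simp add: powr_mult mult_right_mono)
    next
      case 2
      then show ?thesis using small[of a] assms that by (simp add: powr_mult mult_right_mono)
    next
      case 3
      have a: "a = 1 - b" using assms(4) by simp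
      show ?thesis
        using convex_onD[OF powr_convex[OF assms(1)], of b s t] 3 assms(2,3) a by simp
    qed
  qed
  have "\<bar>a * u + b * v\<bar> \<le> a * \<bar>u\<bar> + b * \<bar>v\<bar>"
    using abs_triangle_ineq[of "a * u" "b * v"] assms by (simp add: abs_mult)
  then have "\<bar>a * u + b * v\<bar> powr q \<le> (a * \<bar>u\<bar> + b * \<bar>v\<bar>) powr q"
    using assms(1) by (intro powr_mono2) auto
  also have "\<dots> \<le> a * \<bar>u\<bar> powr q + b * \<bar>v\<bar> powr q"
    by (rule pos) auto
  finally show ?thesis .
qed

locale exponent =
  fixes p :: "real \<Rightarrow> ennreal"
  assumes p_measurable: "p \<in> borel_measurable I_measure"
    and p_bounds: "AE x in I_measure. 1 \<le> p x \<and> p x < \<infinity>"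
begin

lemma AE_p_real: "AE x in I_measure. 1 \<le> enn2real (p x)"
  using p_bounds by (rule eventually_mono) (use enn2real_mono[of 1] in fastforce)

lemma modular_convex:
  assumes "0 \<le> a" "0 \<le> b" "a + b = 1"
  shows "modular p (a *\<^sub>R f + b *\<^sub>R g) \<le> ennreal a * modular p f + ennreal b * modular p g"
proof (transfer fixing: p a b)
  fix f g assume "ae_equal f f" "ae_equal g g"
  then have [measurable]: "f \<in> borel_measurable I_measure" "g \<in> borel_measurable I_measure"
    by (auto simp: ae_equal_def)
  note p_measurable[measurable]
  have "(\<integral>\<^sup>+x. ennreal (\<bar>a * f x + b * g x\<bar> powr enn2real (p x)) \<partial>I_measure) \<le>
     (\<integral>\<^sup>+x. (ennreal a * ennreal (\<bar>f x\<bar> powr enn2real (p x)) + ennreal b * ennreal (\<bar>g x\<bar> powr enn2real (p x))) \<partial>I_measure)"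
  proof (rule nn_integral_mono_AE, rule eventually_mono[OF AE_p_real])
    fix x assume "1 \<le> enn2real (p x)"
    from powr_convex_abs[OF this assms, of "f x" "g x"]
    show "ennreal (\<bar>a * f x + b * g x\<bar> powr enn2real (p x)) \<le> ennreal a * ennreal (\<bar>f x\<bar> powr enn2real (p x)) + ennreal b * ennreal (\<bar>g x\<bar> powr enn2real (p x))"
      using assms by (simp add: ennreal_leI flip: ennreal_mult ennreal_plus)
  qed
  also have "\<dots> = ennreal a * (\<integral>\<^sup>+x. ennreal (\<bar>f x\<bar> powr enn2real (p x)) \<partial>I_measure) + ennreal b * (\<integral>\<^sup>+x. ennreal (\<bar>g x\<bar> powr enn2real (p x)) \<partial>I_measure)"
    by (subst nn_integral_add) (auto simp: nn_integral_cmult)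
  finally show "(\<integral>\<^sup>+x. ennreal (\<bar>a * f x + b * g x\<bar> powr enn2real (p x)) \<partial>I_measure) \<le>
    ennreal a * (\<integral>\<^sup>+x. ennreal (\<bar>f x\<bar> powr enn2real (p x)) \<partial>I_measure) + ennreal b * (\<integral>\<^sup>+x. ennreal (\<bar>g x\<bar> powr enn2real (p x)) \<partial>I_measure)" .
qed

lemma modular_zero [simp]: "modular p 0 = 0"
  by transfer simp

lemma modular_uminus [simp]: "modular p (- f) = modular p f"
  by transfer simp

lemma modular_scale: "0 \<le> a \<Longrightarrow> a \<le> 1 \<Longrightarrow> modular p (a *\<^sub>R f) \<le> ennreal a * modular p f"
  using modular_convex[of a "1 - a" f 0] by simp

lemma modular_eq_0: 
  assumes "modular p f = 0" shows "f = 0"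
  using assms
proof (transfer fixing: p)
  fix f assume "ae_equal f f"
  then have [measurable]: "f \<in> borel_measurable I_measure" by (auto simp: ae_equal_def)
  note p_measurable[measurable]
  assume "(\<integral>\<^sup>+x. ennreal (\<bar>f x\<bar> powr enn2real (p x)) \<partial>I_measure) = 0"
  then have "AE x in I_measure. f x = 0"
    by (subst (asm) nn_integral_0_iff_AE) (auto elim: eventually_mono)
  then show "ae_equal f (\<lambda>_. 0)" by (simp add: ae_equal_def)
qed

lemma Lp_space_obtain:
  assumes "f \<in> Lp_space p" obtains l where "0 < l" "modular p (f /\<^sub>R l) \<le> 1"
proof -
  obtain l where l: "0 < l" "modular p (f /\<^sub>R l) < \<infinity>" using assms by (auto simp: Lp_space_def)
  then obtain K where K: "0 \<le> K" "modular p (f /\<^sub>R l) = ennreal K" by (cases "modular p (f /\<^sub>R l)") auto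
  define c where "c = 1 / (K + 1)"
  have c: "0 < c" "c \<le> 1" "c * K \<le> 1" using K by (auto simp: c_def field_simps)
  have "modular p (c *\<^sub>R (f /\<^sub>R l)) \<le> ennreal c * ennreal K"
    using modular_scale[of c "f /\<^sub>R l"] c K by simp
  also have "\<dots> \<le> 1" using c K by (simp flip: ennreal_mult)
  finally show ?thesis using that[of "l / c"] l c by (simp add: field_simps)
qed

lemma Lp_norm_less_top: "f \<in> Lp_space p \<Longrightarrow> Lp_norm p f < \<infinity>"
  unfolding Lp_norm_def INF_less_iff by (erule Lp_space_obtain) auto

lemma modular_add:
  assumes "0 < l" "0 < k" "modular p (f /\<^sub>R l) \<le> 1" "modular p (g /\<^sub>R k) \<le> 1"
  shows "modular p ((f + g) /\<^sub>R (l + k)) \<le> 1"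
proof -
  define a b where "a = l / (l + k)" and "b = k / (l + k)"
  have ab: "0 \<le> a" "0 \<le> b" "a + b = 1"
    using assms(1,2) by (auto simp: a_def b_def simp flip: add_divide_distrib)
  have "a * inverse l = inverse (l + k)" "b * inverse k = inverse (l + k)"
    using assms(1,2) by (auto simp: a_def b_def divide_inverse)
  then have "(f + g) /\<^sub>R (l + k) = a *\<^sub>R (f /\<^sub>R l) + b *\<^sub>R (g /\<^sub>R k)"
    by (simp add: scaleR_add_right)
  then have "modular p ((f + g) /\<^sub>R (l + k)) \<le> ennreal a * modular p (f /\<^sub>R l) + ennreal b * modular p (g /\<^sub>R k)"
    by (simp only: modular_convex[OF ab])
  also have "\<dots> \<le> ennreal a * 1 + ennreal b * 1"
    using assms by (intro add_mono mult_left_mono) auto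
  also have "\<dots> = 1" using ab by (simp flip: ennreal_plus)
  finally show ?thesis .
qed

lemma Lp_space_minus:
  assumes "f \<in> Lp_space p" "g \<in> Lp_space p" shows "f - g \<in> Lp_space p"
proof -
  obtain l k where lk: "0 < l" "modular p (f /\<^sub>R l) \<le> 1" "0 < k" "modular p (g /\<^sub>R k) \<le> 1"
    using assms by (metis Lp_space_obtain)
  then have "modular p ((f - g) /\<^sub>R (l + k)) \<le> 1"
    using modular_add[of l k f "- g"] by simp
  then show ?thesis using lk unfolding Lp_space_def
    by (auto intro!: exI[of _ "l + k"] simp: order_le_less_trans)
qed

lemma Lp_norm_triangle: "Lp_norm p (f + g) \<le> Lp_norm p f + Lp_norm p g"
proof -
  let ?S = "\<lambda>f. {l. 0 < l \<and> modular p (f /\<^sub>R l) \<le> 1}"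
  have 1: "Lp_norm p (f + g) \<le> ennreal l + ennreal k" if "l \<in> ?S f" "k \<in> ?S g" for l k
    using that modular_add[of l k f g] unfolding Lp_norm_def
    by (auto intro!: INF_lower2[of "l + k"] simp flip: ennreal_plus)
  have approx: "\<exists>l \<in> ?S h. ennreal l < Lp_norm p h + ennreal e" if "0 < e" "Lp_norm p h < top" for h e
  proof -
    have "Lp_norm p h < Lp_norm p h + ennreal e"
      using that by (cases "Lp_norm p h") (auto simp: ennreal_less_iff simp flip: ennreal_plus)
    then show ?thesis by (subst (asm) (1) Lp_norm_def) (simp add: INF_less_iff)
  qed
  show ?thesis
  proof (rule ennreal_le_epsilon)
    fix e :: real assume fin: "Lp_norm p f + Lp_norm p g < top" and e: "0 < e"
    obtain l where l: "l \<in> ?S f" "ennreal l < Lp_norm p f + ennreal (e / 2)"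
      using approx[of "e / 2" f] fin e by auto
    obtain k where k: "k \<in> ?S g" "ennreal k < Lp_norm p g + ennreal (e / 2)"
      using approx[of "e / 2" g] fin e by auto
    have "Lp_norm p (f + g) \<le> ennreal l + ennreal k"
      by (rule 1[OF l(1) k(1)])
    also have "\<dots> \<le> (Lp_norm p f + ennreal (e / 2)) + (Lp_norm p g + ennreal (e / 2))"
      using l k by (intro add_mono) auto
    also have "\<dots> = Lp_norm p f + Lp_norm p g + (ennreal (e / 2) + ennreal (e / 2))"
      by (simp only: ac_simps)
    also have "ennreal (e / 2) + ennreal (e / 2) = ennreal e"
      using e by (simp flip: ennreal_plus)
    finally show "Lp_norm p (f + g) \<le> Lp_norm p f + Lp_norm p g + ennreal e" .
  qed
qed

lemma Lp_norm_zero [simp]: "Lp_norm p 0 = 0"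
proof -
  have "Lp_norm p 0 \<le> ennreal e" if "0 < e" for e
    unfolding Lp_norm_def using that by (auto intro!: INF_lower)
  then show ?thesis by (metis ennreal_le_epsilon add_0 le_zero_eq)
qed

lemma Lp_norm_eq_0:
  assumes "Lp_norm p f = 0" shows "f = 0"
proof (rule modular_eq_0)
  have "modular p f \<le> 0 + ennreal e" if "0 < e" for e
  proof -
    have "Lp_norm p f < ennreal (min e 1)" using assms that by (simp add: min_def)
    then obtain l where l: "0 < l" "modular p (f /\<^sub>R l) \<le> 1" "ennreal l < ennreal (min e 1)"
      unfolding Lp_norm_def INF_less_iff by auto
    then have l': "l < min e 1" by (simp add: ennreal_less_iff)
    have "modular p f = modular p (l *\<^sub>R (f /\<^sub>R l))" using l by simp
    also have "\<dots> \<le> ennreal l * modular p (f /\<^sub>R l)" using l l' by (intro modular_scale) auto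
    also have "\<dots> \<le> ennreal l * 1" using l by (intro mult_left_mono) auto
    also have "\<dots> \<le> ennreal e" using l' by (simp add: ennreal_leI)
    finally show ?thesis by simp
  qed
  then show "modular p f = 0" by (metis ennreal_le_epsilon le_zero_eq)
qed

lemma Lp_norm_uminus [simp]: "Lp_norm p (- f) = Lp_norm p f"
  by (simp add: Lp_norm_def)

lemma Metric_space_Lp: "Metric_space (Lp_space p) (Lp_dist p)"
proof
  show "0 \<le> Lp_dist p f g" for f g by (simp add: Lp_dist_def)
  show "Lp_dist p f g = Lp_dist p g f" for f g
    unfolding Lp_dist_def by (metis Lp_norm_uminus minus_diff_eq)
  show "Lp_dist p f g = 0 \<longleftrightarrow> f = g" if "f \<in> Lp_space p" "g \<in> Lp_space p" for f g
    using Lp_norm_less_top[OF Lp_space_minus[OF that]] Lp_norm_eq_0[of "f - g"]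
    by (auto simp: Lp_dist_def enn2real_eq_0_iff)
  show "Lp_dist p f h \<le> Lp_dist p f g + Lp_dist p g h"
    if "f \<in> Lp_space p" "g \<in> Lp_space p" "h \<in> Lp_space p" for f g h
  proof -
    have fin: "Lp_norm p (f - g) < \<infinity>" "Lp_norm p (g - h) < \<infinity>"
      using that by (auto intro!: Lp_norm_less_top Lp_space_minus simp del: infinity_ennreal_def)
    have "Lp_norm p (f - h) \<le> Lp_norm p (f - g) + Lp_norm p (g - h)"
      using Lp_norm_triangle[of "f - g" "g - h"] by simp
    then have "enn2real (Lp_norm p (f - h)) \<le> enn2real (Lp_norm p (f - g) + Lp_norm p (g - h))"
      using fin by (intro enn2real_mono) auto
    then show ?thesis using fin by (simp add: Lp_dist_def enn2real_plus)
  qed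
qed

end

text \<open>The image of \<open>C([0,1])\<close> in \<^typ>\<open>L0\<close>; \<open>abs_L0_continuous_inj\<close> shows that a continuous function
  is determined on \<open>[0,1]\<close> by its class.\<close>

definition C_I :: "L0 set"
  where "C_I = abs_L0 ` {f. continuous_on {0..1} f}"

lemma abs_L0_continuous_inj:
  assumes "continuous_on {0..1} f" "continuous_on {0..1} g" "abs_L0 f = abs_L0 g" "x \<in> {0..1}"
  shows "f x = g x"
proof -
  have fg: "f \<in> borel_measurable I_measure" "g \<in> borel_measurable I_measure"
    by (rule continuous_imp_measurable_on_sets_lebesgue, fact, simp)+
  then have "ae_equal f g"
    using assms(3) Quotient3_rel[OF Quotient3_L0, of f g] by (simp add: ae_equal_def)
  then have "AE x in I_measure. f x = g x"
    by (simp add: ae_equal_def)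
  then obtain N where N: "N \<in> null_sets I_measure" "{x \<in> space I_measure. f x \<noteq> g x} \<subseteq> N"
    by (auto simp: eventually_ae_filter)
  have negN: "negligible N"
    using N(1) by (simp add: negligible_iff_null_sets null_sets_restrict_space)
  show ?thesis
  proof (rule ccontr)
    assume "f x \<noteq> g x"
    moreover have c: "continuous_on {0..1} (\<lambda>x. f x - g x)"
      using assms by (intro continuous_intros)
    ultimately have "\<exists>d>0. \<forall>y\<in>{0..1}. dist y x < d \<longrightarrow> dist (f y - g y) (f x - g x) < \<bar>f x - g x\<bar>"
      using assms(4) unfolding continuous_on_iff by force
    then obtain d where d: "d > 0" "\<And>y. y \<in> {0..1} \<Longrightarrow> dist y x < d \<Longrightarrow> dist (f y - g y) (f x - g x) < \<bar>f x - g x\<bar>"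
      by blast
    define a b where "a = max 0 (x - d/2)" and "b = min 1 (x + d/2)"
    have ab: "a < b" using d(1) assms(4) by (auto simp: a_def b_def)
    have "{a..b} \<subseteq> N"
    proof
      fix y assume "y \<in> {a..b}"
      then have "y \<in> {0..1}" "dist y x < d" using d(1) assms(4) by (auto simp: a_def b_def dist_real_def)
      then show "y \<in> N" using d(2)[of y] N(2) by (auto simp: dist_real_def)
    qed
    then have "negligible {a..b}" using negN negligible_subset by blast
    then show False using ab negligible_interval(1)[of a b] by (auto simp: cbox_interval box_real)
  qed
qed

definition m_fun :: "real \<Rightarrow> real"
  where "m_fun x = indicator {0<..<1/200} x * ln (1 / x)"

text \<open>The series is taken in \<^typ>\<open>ennreal\<close>, so it may be infinite at some points. All its terms are
  nonnegative, hence \<^const>\<open>ennreal\<close> truncates nothing.\<close>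

definition p_tilde :: "(nat \<Rightarrow> real) \<Rightarrow> (nat \<Rightarrow> real) \<Rightarrow> real \<Rightarrow> ennreal"
  where "p_tilde \<delta> r x =
    2 + (\<Sum>k. ennreal (m_fun (x - r k) * indicator {r k<..<r k + \<delta> k} x))"

end

theory Submission
  imports Defs "HOL-Real_Asymp.Real_Asymp"
begin

text \<open>
  The Luxemburg norm of \<open>L\<^sup>p\<close> is always at most the supremum norm, because \<open>[0,1]\<close> has measure \<open>1\<close>.
  The exponent \<open>p_tilde\<close> is so large near each point of a dense set that, on continuous functions, the
  two norms are in fact equivalent: \<open>sup \<bar>f\<bar> \<le> e \<parallel>f\<parallel>\<close>. Completeness of \<open>C([0,1])\<close> under
  the supremum norm then makes it closed.

  The reverse inequality rests on one property of the exponent \<open>p\<close>: the function \<open>exp p\<close> is not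
  integrable on any nondegenerate subinterval of \<open>[0,1]\<close>. If \<open>f\<close> is continuous and \<open>\<bar>f\<bar> > e l\<close> at
  some point, then \<open>\<bar>f / l\<bar> \<ge> e\<close> on a whole interval, so \<open>\<bar>f / l\<bar> powr p \<ge> exp p\<close> there
  and the modular of \<open>f / l\<close> is infinite (\<open>abs_le_if_modular_finite\<close>). Hence every \<open>l\<close> that competes
  in the infimum defining the norm satisfies \<open>\<bar>f\<bar> \<le> e l\<close> everywhere (\<open>sup_le_Lp_dist\<close>).

  For \<open>p_tilde\<close> the property holds because every interval contains some \<open>r k\<close> in its interior, and
  just to the right of it \<open>p_tilde x \<ge> ln (1 / (x - r k))\<close>, so that \<open>exp (p_tilde x) \<ge> 1 / (x - r k)\<close>
  (\<open>exp_p_tilde_blowup\<close>). This needs \<open>p_tilde\<close> to be finite almost everywhere, which follows by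
  integrating the series term by term (\<open>p_tilde_finite_AE\<close>).
\<close>

section \<open>Exponents with a non-integrable exponential\<close>

lemma continuous_on_I_measurable:
  assumes "continuous_on {0..1} f"
  shows "f \<in> borel_measurable I_measure"
  using assms by (intro continuous_imp_measurable_on_sets_lebesgue) simp_all

lemma ae_equal_refl: "f \<in> borel_measurable I_measure \<Longrightarrow> ae_equal f f"
  by (simp add: ae_equal_def)

lemma abs_L0_diff:
  assumes "f \<in> borel_measurable I_measure" "g \<in> borel_measurable I_measure"
  shows "abs_L0 f - abs_L0 g = abs_L0 (\<lambda>x. f x - g x)"
  using assms by (simp add: minus_L0.abs_eq ae_equal_refl)

text \<open>Computes the modular from a representative, so that the norm estimates below can be carried out on
  functions instead of classes.\<close>

lemma modular_abs_L0_scaled: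
  assumes "f \<in> borel_measurable I_measure"
  shows "modular p (abs_L0 f /\<^sub>R l) = (\<integral>\<^sup>+x. ennreal (\<bar>f x / l\<bar> powr enn2real (p x)) \<partial>I_measure)"
proof -
  have "ae_equal (\<lambda>x. inverse l * f x) (\<lambda>x. inverse l * f x)"
    using assms by (intro ae_equal_refl) measurable
  then show ?thesis
    using assms
    by (simp add: scaleR_L0.abs_eq modular.abs_eq ae_equal_refl divide_inverse mult.commute)
qed

lemma subspace_C_I: "subspace C_I"
proof (rule subspaceI)
  have "0 = abs_L0 (\<lambda>_. 0)" by (simp add: zero_L0_def)
  then show "0 \<in> C_I" unfolding C_I_def by (intro image_eqI[of _ _ "\<lambda>_. 0"]) auto
next
  fix u v assume "u \<in> C_I" "v \<in> C_I"
  then obtain f g where "u = abs_L0 f" "continuous_on {0..1} f" "v = abs_L0 g" "continuous_on {0..1} g"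
    by (auto simp: C_I_def)
  then show "u + v \<in> C_I"
    unfolding C_I_def
    by (intro image_eqI[of _ _ "\<lambda>x. f x + g x"])
      (simp_all add: plus_L0.abs_eq ae_equal_refl continuous_on_I_measurable continuous_on_add)
next
  fix c :: real and u assume "u \<in> C_I"
  then obtain f where "u = abs_L0 f" "continuous_on {0..1} f"
    by (auto simp: C_I_def)
  then show "c *\<^sub>R u \<in> C_I"
    unfolding C_I_def
    by (intro image_eqI[of _ _ "\<lambda>x. c * f x"])
      (simp_all add: scaleR_L0.abs_eq ae_equal_refl continuous_on_I_measurable continuous_on_mult_left)
qed

text \<open>A number in \<open>[0,1]\<close> stays there under every nonnegative power, and the underlying measure is a probability
  measure. The argument covers the value \<open>0\<close> that \<^const>\<open>enn2real\<close> assigns to an infinite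
  exponent.\<close>

lemma modular_le_1_if_bounded:
  assumes "f \<in> borel_measurable I_measure" "0 < l" "\<And>x. x \<in> {0..1} \<Longrightarrow> \<bar>f x\<bar> \<le> l"
  shows "modular p (abs_L0 f /\<^sub>R l) \<le> 1"
proof -
  have "(\<integral>\<^sup>+x. ennreal (\<bar>f x / l\<bar> powr enn2real (p x)) \<partial>I_measure) \<le> (\<integral>\<^sup>+x. 1 \<partial>I_measure)"
  proof (rule nn_integral_mono)
    fix x assume "x \<in> space I_measure"
    then have "\<bar>f x / l\<bar> \<le> 1" using assms by simp
    then have "\<bar>f x / l\<bar> powr enn2real (p x) \<le> 1" by (intro powr_le1) auto
    then show "ennreal (\<bar>f x / l\<bar> powr enn2real (p x)) \<le> 1" by simp
  qed
  also have "\<dots> = 1" by (simp add: emeasure_restrict_space)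
  finally show ?thesis using assms(1) by (simp add: modular_abs_L0_scaled)
qed

lemma C_I_subset_Lp_space: "C_I \<subseteq> Lp_space p"
proof
  fix u assume "u \<in> C_I"
  then obtain f where f: "u = abs_L0 f" "continuous_on {0..1} f" by (auto simp: C_I_def)
  obtain B where B: "0 < B" "\<And>x. x \<in> {0..1} \<Longrightarrow> \<bar>f x\<bar> \<le> B"
    using compact_imp_bounded[OF compact_continuous_image[OF f(2)]]
    by (auto simp: bounded_pos)
  have "modular p (u /\<^sub>R B) \<le> 1"
    unfolding f(1) using f(2) B by (intro modular_le_1_if_bounded continuous_on_I_measurable)
  then show "u \<in> Lp_space p"
    unfolding Lp_space_def using B(1) by (auto intro!: exI[of _ B] simp: order_le_less_trans)
qed

lemma Lp_dist_le_sup: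
  assumes "continuous_on {0..1} f" "continuous_on {0..1} g" "0 < l"
    and "\<And>x. x \<in> {0..1} \<Longrightarrow> \<bar>f x - g x\<bar> \<le> l"
  shows "Lp_dist p (abs_L0 f) (abs_L0 g) \<le> l"
proof -
  have "(\<lambda>x. f x - g x) \<in> borel_measurable I_measure"
    using assms(1,2) by (intro continuous_on_I_measurable continuous_on_diff)
  then have "modular p ((abs_L0 f - abs_L0 g) /\<^sub>R l) \<le> 1"
    using assms modular_le_1_if_bounded[of "\<lambda>x. f x - g x" l p]
    by (simp add: abs_L0_diff continuous_on_I_measurable)
  then have "Lp_norm p (abs_L0 f - abs_L0 g) \<le> ennreal l"
    unfolding Lp_norm_def using assms(3) by (auto intro!: INF_lower)
  then show ?thesis
    unfolding Lp_dist_def using assms(3) by (simp add: enn2real_leI)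
qed

text \<open>The heart of the matter. Continuity spreads a violation of the bound at \<open>x\<close> to an interval, and
  the base \<open>e\<close> is exactly what turns \<open>\<bar>f / l\<bar> powr p\<close> into something that dominates \<open>exp p\<close>.\<close>

lemma abs_le_if_modular_finite:
  assumes blowup: "\<And>a b. 0 \<le> a \<Longrightarrow> a < b \<Longrightarrow> b \<le> 1 \<Longrightarrow>
      (\<integral>\<^sup>+x\<in>{a..b}. ennreal (exp (enn2real (p x))) \<partial>I_measure) = \<infinity>"
    and f: "continuous_on {0..1} f" and "0 < l" "modular p (abs_L0 f /\<^sub>R l) < \<infinity>"
    and x: "x \<in> {0..1}"
  shows "\<bar>f x\<bar> \<le> exp 1 * l"
proof (rule ccontr)
  assume "\<not> ?thesis"
  then have gt: "0 < \<bar>f x\<bar> - exp 1 * l" by simp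
  obtain d where d: "d > 0" "\<And>y. y \<in> {0..1} \<Longrightarrow> dist y x < d \<Longrightarrow> dist (f y) (f x) < \<bar>f x\<bar> - exp 1 * l"
    using f gt x unfolding continuous_on_iff by metis
  define a b where "a = max 0 (x - d/2)" and "b = min 1 (x + d/2)"
  have ab: "0 \<le> a" "a < b" "b \<le> 1" using d(1) x by (auto simp: a_def b_def)
  have large: "exp 1 \<le> \<bar>f y / l\<bar>" if "y \<in> {a..b}" for y
  proof -
    have "y \<in> {0..1}" "dist y x < d" using that d(1) x by (auto simp: a_def b_def dist_real_def)
    from d(2)[OF this] have "exp 1 * l \<le> \<bar>f y\<bar>" by (simp add: dist_real_def)
    then show ?thesis using \<open>0 < l\<close> by (simp add: abs_divide pos_le_divide_eq)
  qed
  have "\<infinity> = (\<integral>\<^sup>+x\<in>{a..b}. ennreal (exp (enn2real (p x))) \<partial>I_measure)"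
    using blowup[OF ab] by simp
  also have "\<dots> \<le> (\<integral>\<^sup>+x. ennreal (\<bar>f x / l\<bar> powr enn2real (p x)) \<partial>I_measure)"
  proof (rule nn_integral_mono)
    fix y
    have "exp (enn2real (p y)) \<le> \<bar>f y / l\<bar> powr enn2real (p y)" if "y \<in> {a..b}"
      using powr_mono2[OF _ _ large[OF that], of "enn2real (p y)"] by (simp add: powr_def)
    then show "ennreal (exp (enn2real (p y))) * indicator {a..b} y \<le> ennreal (\<bar>f y / l\<bar> powr enn2real (p y))"
      by (auto simp: indicator_def intro: ennreal_leI)
  qed
  finally show False
    using assms(4) f by (simp add: modular_abs_L0_scaled continuous_on_I_measurable)
qed

context exponent
begin

text \<open>The bound of \<open>abs_le_if_modular_finite\<close> passes to the infimum over \<open>l\<close>. Membership in \<open>Lp_space p\<close>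
  matters here: it makes the extended norm finite, so that its conversion to a real loses nothing.\<close>

lemma sup_le_Lp_dist:
  assumes blowup: "\<And>a b. 0 \<le> a \<Longrightarrow> a < b \<Longrightarrow> b \<le> 1 \<Longrightarrow>
      (\<integral>\<^sup>+x\<in>{a..b}. ennreal (exp (enn2real (p x))) \<partial>I_measure) = \<infinity>"
    and f: "continuous_on {0..1} f" and g: "continuous_on {0..1} g" and x: "x \<in> {0..1}"
  shows "\<bar>f x - g x\<bar> \<le> exp 1 * Lp_dist p (abs_L0 f) (abs_L0 g)"
proof -
  let ?h = "abs_L0 (\<lambda>x. f x - g x)"
  have h: "continuous_on {0..1} (\<lambda>x. f x - g x)" using f g by (intro continuous_intros)
  have "?h \<in> Lp_space p" using C_I_subset_Lp_space[of p] h by (auto simp: C_I_def)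
  then have fin: "Lp_norm p ?h < \<infinity>" by (rule Lp_norm_less_top)
  have "ennreal (\<bar>f x - g x\<bar> / exp 1) \<le> Lp_norm p ?h"
    unfolding Lp_norm_def
  proof (rule INF_greatest)
    fix l assume "l \<in> {l. 0 < l \<and> modular p (?h /\<^sub>R l) \<le> 1}"
    then have l: "0 < l" "modular p (?h /\<^sub>R l) < \<infinity>" by (auto simp: order_le_less_trans)
    have "\<bar>f x - g x\<bar> \<le> exp 1 * l"
      by (rule abs_le_if_modular_finite[OF blowup h l x])
    then show "ennreal (\<bar>f x - g x\<bar> / exp 1) \<le> ennreal l"
      by (intro ennreal_leI) (simp add: divide_simps mult.commute)
  qed
  then have "\<bar>f x - g x\<bar> / exp 1 \<le> enn2real (Lp_norm p ?h)"
    using fin enn2real_mono by fastforce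
  then show ?thesis
    using f g unfolding Lp_dist_def
    by (simp add: abs_L0_diff continuous_on_I_measurable divide_simps mult.commute)
qed

text \<open>A sequence of continuous functions that converges in norm is Cauchy in norm, hence uniformly Cauchy.
  Its uniform limit is continuous and is also the limit in norm, so it is the given limit.\<close>

lemma closedin_C_I:
  assumes blowup: "\<And>a b. 0 \<le> a \<Longrightarrow> a < b \<Longrightarrow> b \<le> 1 \<Longrightarrow>
      (\<integral>\<^sup>+x\<in>{a..b}. ennreal (exp (enn2real (p x))) \<partial>I_measure) = \<infinity>"
  shows "closedin (Metric_space.mtopology (Lp_space p) (Lp_dist p)) C_I"
proof -
  interpret L: Metric_space "Lp_space p" "Lp_dist p" by (rule Metric_space_Lp)
  show ?thesis
    unfolding L.metric_closedin_iff_sequentially_closed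
  proof (intro conjI allI impI C_I_subset_Lp_space)
    fix \<sigma> u assume "range \<sigma> \<subseteq> C_I \<and> limitin L.mtopology \<sigma> u sequentially"
    then have C: "\<And>n. \<sigma> n \<in> C_I" and lim: "limitin L.mtopology \<sigma> u sequentially" by auto
    obtain f where f: "\<And>n. \<sigma> n = abs_L0 (f n)" "\<And>n. continuous_on {0..1} (f n)"
      using C unfolding C_I_def image_iff by (metis mem_Collect_eq)
    have Cauchy: "L.MCauchy \<sigma>"
      using L.convergent_imp_MCauchy[OF _ lim] C C_I_subset_Lp_space by blast
    have "uniformly_Cauchy_on {0..1} f"
    proof (rule uniformly_Cauchy_onI)
      fix e :: real assume "0 < e"
      then obtain N where N: "\<And>m n. N \<le> m \<Longrightarrow> N \<le> n \<Longrightarrow> Lp_dist p (\<sigma> m) (\<sigma> n) < e / exp 1"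
        using Cauchy unfolding L.MCauchy_def by (metis divide_pos_pos exp_gt_zero)
      show "\<exists>M. \<forall>x\<in>{0..1}. \<forall>m\<ge>M. \<forall>n\<ge>M. dist (f m x) (f n x) < e"
      proof (intro exI[of _ N] ballI allI impI)
        fix x :: real and m n assume "x \<in> {0..1}" "N \<le> m" "N \<le> n"
        have "\<bar>f m x - f n x\<bar> \<le> exp 1 * Lp_dist p (\<sigma> m) (\<sigma> n)"
          unfolding f(1) by (rule sup_le_Lp_dist[OF blowup f(2) f(2) \<open>x \<in> {0..1}\<close>])
        also have "\<dots> < exp 1 * (e / exp 1)"
          using N[OF \<open>N \<le> m\<close> \<open>N \<le> n\<close>] by (intro mult_strict_left_mono) auto
        finally show "dist (f m x) (f n x) < e" by (simp add: dist_real_def)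
      qed
    qed
    then obtain g where g: "uniform_limit {0..1} f g sequentially"
      using Cauchy_uniformly_convergent unfolding uniformly_convergent_on_def by blast
    have gc: "continuous_on {0..1} g"
      by (rule uniform_limit_theorem[OF _ g]) (auto simp: f(2))
    then have gC: "abs_L0 g \<in> C_I" by (auto simp: C_I_def)
    have "limitin L.mtopology \<sigma> (abs_L0 g) sequentially"
      unfolding L.limitin_metric
    proof (intro conjI allI impI)
      show "abs_L0 g \<in> Lp_space p" using gC C_I_subset_Lp_space by blast
      fix e :: real assume "0 < e"
      then have "\<forall>\<^sub>F n in sequentially. \<forall>x\<in>{0..1}. dist (f n x) (g x) < e / 2"
        using g unfolding uniform_limit_iff by (meson half_gt_zero)
      then show "\<forall>\<^sub>F n in sequentially. \<sigma> n \<in> Lp_space p \<and> Lp_dist p (\<sigma> n) (abs_L0 g) < e"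
      proof (rule eventually_mono)
        fix n assume *: "\<forall>x\<in>{0..1}. dist (f n x) (g x) < e / 2"
        have "Lp_dist p (\<sigma> n) (abs_L0 g) \<le> e / 2"
          unfolding f(1) using * \<open>0 < e\<close>
          by (intro Lp_dist_le_sup f(2) gc) (auto simp: dist_real_def less_imp_le)
        then show "\<sigma> n \<in> Lp_space p \<and> Lp_dist p (\<sigma> n) (abs_L0 g) < e"
          using \<open>0 < e\<close> C[of n] C_I_subset_Lp_space by auto
      qed
    qed
    then have "u = abs_L0 g"
      using L.limitin_metric_unique[OF lim] by simp
    then show "u \<in> C_I" using gC by simp
  qed
qed

end

section \<open>The exponent built from logarithmic singularities\<close>

lemma continuous_on_times_ln: "continuous_on {0..} (\<lambda>x::real. x * ln x)"
  unfolding continuous_on_eq_continuous_within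
proof
  fix x :: real assume "x \<in> {0..}"
  show "continuous (at x within {0..}) (\<lambda>x. x * ln x)"
  proof (cases "x = 0")
    case True
    have "((\<lambda>x::real. x * ln x) \<longlongrightarrow> 0) (at_right 0)" by real_asymp
    then show ?thesis
      using True by (simp add: continuous_within at_within_Ici_at_right)
  next
    case False
    then have "isCont (\<lambda>x. x * ln x) x" by (intro continuous_intros) simp_all
    then show ?thesis by (rule continuous_at_imp_continuous_at_within)
  qed
qed

text \<open>The singularity is translated to \<open>r\<close>, so that the same antiderivative serves the summands of
  \<open>p_tilde\<close> and the integrals in the summability hypothesis. At the left end point it is continuous
  because \<open>y ln y\<close> tends to \<open>0\<close> (and \<open>0 * ln 0 = 0\<close>).\<close>

lemma has_integral_ln_inverse:
  fixes r d :: real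
  assumes "0 \<le> d"
  shows "((\<lambda>x. ln (1 / (x - r))) has_integral (d - d * ln d)) {r..r + d}"
proof -
  let ?F = "\<lambda>x. (x - r) - (x - r) * ln (x - r)"
  have "((\<lambda>x. ln (1 / (x - r))) has_integral ?F (r + d) - ?F r) {r..r + d}"
  proof (rule fundamental_theorem_of_calculus_interior)
    show "r \<le> r + d" using assms by simp
    show "continuous_on {r..r + d} ?F"
      by (intro continuous_on_diff continuous_on_compose2[OF continuous_on_times_ln, of _ "\<lambda>x. x - r"]
          continuous_intros) auto
    fix x assume "x \<in> {r<..<r + d}"
    then show "(?F has_vector_derivative ln (1 / (x - r))) (at x)"
      unfolding has_real_derivative_iff_has_vector_derivative[symmetric]
      by (auto intro!: derivative_eq_intros simp: ln_div)
  qed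
  then show ?thesis by simp
qed

lemma set_integral_ln_inverse:
  fixes d :: real
  assumes "0 \<le> d" "d \<le> 1"
  shows "(LINT x:{0..d}|lebesgue. ln (1 / x)) = d - d * ln d"
proof -
  have I: "((\<lambda>x. ln (1 / x)) has_integral (d - d * ln d)) {0..d}"
    using has_integral_ln_inverse[OF assms(1), of 0] by simp
  have "(\<lambda>x. ln (1 / x)) absolutely_integrable_on {0..d}"
    using I assms
    by (intro nonnegative_absolutely_integrable_1) (auto simp: integrable_on_def ln_div)
  then show ?thesis
    using I by (simp add: set_lebesgue_integral_eq_integral integral_unique)
qed

lemma m_fun_measurable [measurable]: "m_fun \<in> borel_measurable borel"
  unfolding m_fun_def by measurable

lemma p_tilde_measurable: "p_tilde \<delta> r \<in> borel_measurable borel"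
  unfolding p_tilde_def by measurable

text \<open>The cutoff of \<open>m_fun\<close> at \<open>1/200\<close> shortens the interval, which keeps the logarithm nonnegative even
  when \<open>d > 1\<close>.\<close>

lemma nn_integral_p_tilde_summand:
  assumes "0 < d"
  shows "(\<integral>\<^sup>+x. ennreal (m_fun (x - r) * indicator {r<..<r + d} x) \<partial>lborel) \<le>
    ennreal (min d (1/200) - min d (1/200) * ln (min d (1/200)))"
proof -
  let ?d = "min d (1/200)"
  have "(\<integral>\<^sup>+x. ennreal (m_fun (x - r) * indicator {r<..<r + d} x) \<partial>lborel) \<le>
    (\<integral>\<^sup>+x. ennreal (ln (1 / (x - r))) * indicator {r..r + ?d} x \<partial>lborel)"
    by (intro nn_integral_mono) (auto simp: m_fun_def indicator_def)
  also have "\<dots> = ennreal (?d - ?d * ln ?d)"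
    using assms by (intro nn_integral_has_integral_lebesgue' has_integral_ln_inverse)
      (auto simp: ln_div)
  finally show ?thesis .
qed

text \<open>Monotone convergence: the integrals of the summands have a finite sum, so the sum of the summands is
  finite almost everywhere. The bounds for the summands agree with the terms of the summability hypothesis
  once \<open>\<delta> k < 1/200\<close>, which holds for all but finitely many \<open>k\<close>; the others are finite individually.\<close>

lemma p_tilde_finite_AE:
  assumes pos: "\<And>k. 0 < \<delta> k" and lim: "\<delta> \<longlonglongrightarrow> 0"
    and sum: "summable (\<lambda>k. LINT x:{0..\<delta> k}|lebesgue. ln (1 / x))"
  shows "AE x in lborel. p_tilde \<delta> r x < \<infinity>"
proof -
  define c where "c k = min (\<delta> k) (1/200) - min (\<delta> k) (1/200) * ln (min (\<delta> k) (1/200))" for k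
  have c_nonneg: "0 \<le> c k" for k
  proof -
    let ?d = "min (\<delta> k) (1/200)"
    have "0 < ?d" "?d \<le> 1" using pos[of k] by auto
    then have "?d * ln ?d \<le> 0" by (intro mult_nonneg_nonpos) (auto simp del: min_less_iff_conj)
    then show ?thesis using \<open>0 < ?d\<close> unfolding c_def by linarith
  qed
  have "\<forall>\<^sub>F k in sequentially. \<delta> k < 1/200"
    using lim by (rule order_tendstoD) simp
  then have "\<forall>\<^sub>F k in sequentially. c k = (LINT x:{0..\<delta> k}|lebesgue. ln (1 / x))"
  proof (rule eventually_mono)
    fix k assume "\<delta> k < 1/200"
    then show "c k = (LINT x:{0..\<delta> k}|lebesgue. ln (1 / x))"
      using pos[of k] by (simp add: c_def set_integral_ln_inverse)
  qed
  then have c_sum: "summable c" using sum by (simp add: summable_cong)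
  have "(\<integral>\<^sup>+x. (\<Sum>k. ennreal (m_fun (x - r k) * indicator {r k<..<r k + \<delta> k} x)) \<partial>lborel)
    = (\<Sum>k. \<integral>\<^sup>+x. ennreal (m_fun (x - r k) * indicator {r k<..<r k + \<delta> k} x) \<partial>lborel)"
    by (rule nn_integral_suminf) measurable
  also have "\<dots> \<le> (\<Sum>k. ennreal (c k))"
    unfolding c_def by (intro suminf_le nn_integral_p_tilde_summand pos) auto
  also have "\<dots> < \<infinity>"
    using suminf_ennreal2[OF c_nonneg c_sum] by simp
  finally have "AE x in lborel. (\<Sum>k. ennreal (m_fun (x - r k) * indicator {r k<..<r k + \<delta> k} x)) \<noteq> \<infinity>"
    by (intro nn_integral_PInf_AE) auto
  then show ?thesis
    by (rule eventually_mono) (auto simp: p_tilde_def less_top)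
qed

lemma AE_I_measureI: "AE x in lborel. P x \<Longrightarrow> AE x in I_measure. P x"
  by (auto simp: AE_restrict_space_iff dest: AE_completion)

lemma exponent_p_tilde:
  assumes "\<And>k. 0 < \<delta> k" "\<delta> \<longlonglongrightarrow> 0"
    and "summable (\<lambda>k. LINT x:{0..\<delta> k}|lebesgue. ln (1 / x))"
  shows "exponent (p_tilde \<delta> r)"
proof
  show "p_tilde \<delta> r \<in> borel_measurable I_measure"
    using p_tilde_measurable[of \<delta> r]
    by (intro measurable_restrict_space1 measurable_completion) simp
  have "1 \<le> p_tilde \<delta> r x" for x
    unfolding p_tilde_def by (rule order_trans[of _ 2]) auto
  then show "AE x in I_measure. 1 \<le> p_tilde \<delta> r x \<and> p_tilde \<delta> r x < \<infinity>"
    using AE_I_measureI[OF p_tilde_finite_AE[OF assms]] by simp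
qed

text \<open>All summands are nonnegative, so the \<open>k\<close>-th one alone is a lower bound. Finiteness is essential,
  since \<^const>\<open>enn2real\<close> sends \<open>\<infinity>\<close> to \<open>0\<close>.\<close>

lemma p_tilde_ge_ln:
  assumes "r k < x" "x < r k + \<delta> k" "x < r k + 1/200" "p_tilde \<delta> r x < \<infinity>"
  shows "ln (1 / (x - r k)) \<le> enn2real (p_tilde \<delta> r x)"
proof -
  have "ennreal (ln (1 / (x - r k))) = ennreal (m_fun (x - r k) * indicator {r k<..<r k + \<delta> k} x)"
    using assms by (simp add: m_fun_def)
  also have "\<dots> \<le> (\<Sum>j. ennreal (m_fun (x - r j) * indicator {r j<..<r j + \<delta> j} x))"
    using sum_le_suminf[of "\<lambda>j. ennreal (m_fun (x - r j) * indicator {r j<..<r j + \<delta> j} x)" "{k}"]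
    by simp
  also have "\<dots> \<le> p_tilde \<delta> r x" by (simp add: p_tilde_def)
  finally show ?thesis
    using assms(1,3,4) enn2real_mono[of "ennreal (ln (1 / (x - r k)))" "p_tilde \<delta> r x"]
    by (simp add: ln_div)
qed

text \<open>Starting the integration at distance \<open>(c - r) exp (- t)\<close> from the singularity makes the integral
  exactly \<open>t\<close>, and \<open>t\<close> is arbitrary.\<close>

lemma nn_integral_reciprocal_infinite:
  fixes r c :: real
  assumes "r < c"
  shows "(\<integral>\<^sup>+x\<in>{r<..c}. ennreal (1 / (x - r)) \<partial>lborel) = \<infinity>" (is "?I = _")
proof -
  have large: "ennreal t \<le> (\<integral>\<^sup>+x\<in>{r<..c}. ennreal (1 / (x - r)) \<partial>lborel)" if "0 < t" for t
  proof -
    define \<eta> where "\<eta> = (c - r) * exp (- t)"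
    have \<eta>: "0 < \<eta>" "\<eta> \<le> c - r" using assms that by (auto simp: \<eta>_def mult_le_cancel_left1)
    have "((\<lambda>x. 1 / (x - r)) has_integral (ln (c - r) - ln (r + \<eta> - r))) {r + \<eta>..c}"
    proof (rule fundamental_theorem_of_calculus)
      fix x assume "x \<in> {r + \<eta>..c}"
      then have "r < x" using \<eta> by auto
      then show "((\<lambda>x. ln (x - r)) has_vector_derivative 1 / (x - r)) (at x within {r + \<eta>..c})"
        unfolding has_real_derivative_iff_has_vector_derivative[symmetric]
        by (auto intro!: derivative_eq_intros)
    qed (use \<eta> in auto)
    then have "(\<integral>\<^sup>+x. ennreal (1 / (x - r)) * indicator {r + \<eta>..c} x \<partial>lborel) = ennreal (ln (c - r) - ln (r + \<eta> - r))"
      using \<eta> by (intro nn_integral_has_integral_lebesgue') auto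
    also have "ln (c - r) - ln (r + \<eta> - r) = t"
      using assms by (simp add: \<eta>_def ln_mult)
    finally have "ennreal t = (\<integral>\<^sup>+x\<in>{r + \<eta>..c}. ennreal (1 / (x - r)) \<partial>lborel)" by simp
    also have "\<dots> \<le> (\<integral>\<^sup>+x\<in>{r<..c}. ennreal (1 / (x - r)) \<partial>lborel)"
      using \<eta> by (intro nn_integral_mono) (auto simp: indicator_def)
    finally show ?thesis .
  qed
  show ?thesis
  proof (cases ?I)
    case (real K)
    then show ?thesis using large[of "K + 1"] by (simp add: ennreal_le_iff2)
  qed simp
qed

lemma exp_p_tilde_blowup:
  assumes pos: "\<And>k. 0 < \<delta> k" and fin: "AE x in lborel. p_tilde \<delta> r x < \<infinity>"
    and dense: "{0..1} \<subseteq> closure (range r)"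
    and ab: "0 \<le> a" "a < b" "b \<le> 1"
  shows "(\<integral>\<^sup>+x\<in>{a..b}. ennreal (exp (enn2real (p_tilde \<delta> r x))) \<partial>I_measure) = \<infinity>"
proof -
  have "{a<..<b} \<inter> closure (range r) \<noteq> {}"
  proof -
    have "(a + b) / 2 \<in> closure (range r)" using ab by (intro subsetD[OF dense]) auto
    moreover have "(a + b) / 2 \<in> {a<..<b}" using ab by simp
    ultimately show ?thesis by blast
  qed
  then have "{a<..<b} \<inter> range r \<noteq> {}"
    by (simp add: open_Int_closure_eq_empty)
  then obtain k where k: "a < r k" "r k < b" by auto
  \<comment> \<open>The interval \<open>(r k, c]\<close> has to stay inside \<open>[a,b]\<close>, inside the support \<open>(r k, r k + \<delta> k)\<close> of the
    \<open>k\<close>-th summand and strictly within its cutoff \<open>1/200\<close>; halving the last two lengths ensures strictness.\<close>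
  define c where "c = min b (min (r k + \<delta> k / 2) (r k + 1/400))"
  have c: "r k < c" "c \<le> b" "c < r k + \<delta> k" "c < r k + 1/200"
    using k pos[of k] by (auto simp: c_def min_less_iff_disj)
  have "\<infinity> = (\<integral>\<^sup>+x\<in>{r k<..c}. ennreal (1 / (x - r k)) \<partial>lborel)"
    using nn_integral_reciprocal_infinite[OF c(1)] by simp
  also have "\<dots> \<le> (\<integral>\<^sup>+x. ennreal (exp (enn2real (p_tilde \<delta> r x))) * indicator {a..b} x * indicator {0..1} x \<partial>lborel)"
  proof (rule nn_integral_mono_AE, rule eventually_mono[OF fin])
    fix x assume px: "p_tilde \<delta> r x < \<infinity>"
    show "ennreal (1 / (x - r k)) * indicator {r k<..c} x \<le>
      ennreal (exp (enn2real (p_tilde \<delta> r x))) * indicator {a..b} x * indicator {0..1} x"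
    proof (cases "x \<in> {r k<..c}")
      case True
      then have "1 / (x - r k) = exp (ln (1 / (x - r k)))" by simp
      also have "\<dots> \<le> exp (enn2real (p_tilde \<delta> r x))"
        using True c px by (subst exp_le_cancel_iff, intro p_tilde_ge_ln) auto
      finally show ?thesis using True c k ab by (simp add: ennreal_leI)
    qed simp
  qed
  also have "\<dots> = (\<integral>\<^sup>+x\<in>{a..b}. ennreal (exp (enn2real (p_tilde \<delta> r x))) \<partial>I_measure)"
    by (simp add: nn_integral_restrict_space nn_integral_completion)
  finally show ?thesis by (simp only: infinity_ennreal_def top_unique)
qed

theorem corollary3p3:
  fixes \<delta> r :: "nat \<Rightarrow> real"
  assumes "\<And>k. 0 < \<delta> k"
    and "\<delta> \<longlonglongrightarrow> 0"
    and "summable (\<lambda>k. LINT x:{0..\<delta> k}|lebesgue. ln (1 / x))"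
    and "range r \<subseteq> {0..1}"
    and "{0..1} \<subseteq> closure (range r)"
  shows "subspace C_I \<and> C_I \<subseteq> Lp_space (p_tilde \<delta> r) \<and>
    closedin (Metric_space.mtopology (Lp_space (p_tilde \<delta> r)) (Lp_dist (p_tilde \<delta> r))) C_I"
proof (intro conjI subspace_C_I C_I_subset_Lp_space)
  interpret exponent "p_tilde \<delta> r" by (rule exponent_p_tilde[OF assms(1-3)])
  show "closedin (Metric_space.mtopology (Lp_space (p_tilde \<delta> r)) (Lp_dist (p_tilde \<delta> r))) C_I"
    using exp_p_tilde_blowup[OF assms(1) p_tilde_finite_AE[OF assms(1-3)] assms(5)]
    by (rule closedin_C_I)
qed

end
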